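(* Let $\lambda_1\ge\mu_1$ be positive integers with $\gcd(\lambda_1+1,\mu_1+1)=1$ and $2\mu_1>\lambda_1+1$. Then the pair $(\lambda_1,\mu_1)$ is $(\lambda_1+1)$-initial.
   Context: For a positive integer $r$, a partition with at most $r$ parts is written as a non-increasing $r$-tuple of nonnegative integers; $\mathrm{Par}_r(n)$ is the set of such tuples with entries summing to $n$. For $\lambda,\mu\in\mathrm{Par}_r(n)$, $\lambda$ dominates $\mu$ if $\sum_{i=1}^k\lambda_i\ge\sum_{i=1}^k\mu_i$ for all $k\le r$. The $r$-Kostka cone $\mathcal{K}_r\subseteq\mathbb{R}^{2r}$ is the convex hull of all points $(\lambda_1,\dots,\lambda_r,\mu_1,\dots,\mu_r)$ with $\lambda,\mu\in\mathrm{Par}_r(n)$ for some $n$ and $\lambda$ dominating $\mu$; it is a pointed rational polyhedral cone. Its Hilbert basis is the unique minimal finite set of integer points of $\mathcal{K}_r$ such that every integer point of $\mathcal{K}_r$ is a nonnegative integer combination of them; equivalently, the set of integer points of $\mathcal{K}_r$ that are not nonnegative integer combinations of other integer points of $\mathcal{K}_r$. An integer pair $(\lambda_1,\mu_1)$ is called $r$-initial if there is an element $(\lambda,\mu)$ of the Hilbert basis of $\mathcal{K}_r$ such that the first entry of $\lambda$ is $\lambda_1$ and the first entry of $\mu$ is $\mu_1$. *)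

theory Defs
  imports "HOL-Analysis.Analysis" "HOL-Analysis.Finite_Function_Topology"
begin

text \<open>
  An \<open>r\<close>-tuple is a finitely supported function on \<open>nat\<close> whose support lies in \<open>{1..r}\<close>, and
  \<open>\<real>\<^bsup>2r\<^esup>\<close> is the space of pairs of such real tuples.  The ambient vector space does not
  depend on \<open>r\<close>.
\<close>

definition Par :: "nat \<Rightarrow> nat \<Rightarrow> (nat \<Rightarrow>\<^sub>0 nat) set" where
  "Par r n = {p. Poly_Mapping.keys p \<subseteq> {1..r}
                 \<and> (\<forall>i\<in>{1..<r}. Poly_Mapping.lookup p (Suc i) \<le> Poly_Mapping.lookup p i)
                 \<and> (\<Sum>i=1..r. Poly_Mapping.lookup p i) = n}"

definition dominates :: "nat \<Rightarrow> (nat \<Rightarrow>\<^sub>0 nat) \<Rightarrow> (nat \<Rightarrow>\<^sub>0 nat) \<Rightarrow> bool" where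
  "dominates r p q \<longleftrightarrow>
     (\<forall>k\<le>r. (\<Sum>i=1..k. Poly_Mapping.lookup p i) \<ge> (\<Sum>i=1..k. Poly_Mapping.lookup q i))"

type_synonym point = "(nat \<Rightarrow>\<^sub>0 real) \<times> (nat \<Rightarrow>\<^sub>0 real)"

definition kostka_cone :: "nat \<Rightarrow> point set" where
  "kostka_cone r = convex hull
     {(Poly_Mapping.map real p, Poly_Mapping.map real q) | p q.
        \<exists>n. p \<in> Par r n \<and> q \<in> Par r n \<and> dominates r p q}"

definition integer_points :: "point set \<Rightarrow> point set" where
  "integer_points C =
     {x \<in> C. \<forall>i. Poly_Mapping.lookup (fst x) i \<in> \<int> \<and> Poly_Mapping.lookup (snd x) i \<in> \<int>}"

definition finite_generating_set :: "point set \<Rightarrow> point set \<Rightarrow> bool" where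
  "finite_generating_set C H \<longleftrightarrow>
     finite H \<and> H \<subseteq> integer_points C
     \<and> (\<forall>x\<in>integer_points C. \<exists>c :: point \<Rightarrow> nat. x = (\<Sum>h\<in>H. real (c h) *\<^sub>R h))"

text \<open>
  The definite description is well defined for pointed rational polyhedral cones, where there is
  exactly one inclusion-minimal finite generating set.
\<close>

definition hilbert_basis :: "point set \<Rightarrow> point set" where
  "hilbert_basis C =
     (THE H. finite_generating_set C H
             \<and> (\<forall>H'. finite_generating_set C H' \<and> H' \<subseteq> H \<longrightarrow> H' = H))"

definition initial_pair :: "nat \<Rightarrow> int \<times> int \<Rightarrow> bool" where
  "initial_pair r ab \<longleftrightarrow>
     (\<exists>(x, y) \<in> hilbert_basis (kostka_cone r).
        Poly_Mapping.lookup x 1 = of_int (fst ab) \<and> Poly_Mapping.lookup y 1 = of_int (snd ab))"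

end

theory Submission
  imports Defs
begin

text \<open>
  The integer points of the Kostka cone are the pairs of partitions in dominance order. They form a
  monoid cut out by finitely many linear functionals with values in \<open>\<nat>\<close>, so by Dickson's lemma it
  has finitely many irreducible elements. These generate it and lie in every generating set, hence
  they are the Hilbert basis.

  A partition is a multiset of columns. Let \<open>\<lambda>\<close> have \<open>a\<close> columns of length \<open>s\<close> and one shorter
  column, and let \<open>\<mu>\<close> have \<open>b\<close> columns of length \<open>r\<close>. A decomposition of \<open>(\<lambda>, \<mu>)\<close> splits the
  columns into two groups. If the group without the short column has \<open>j\<close> columns of length \<open>s\<close> and
  \<open>k \<le> b\<close> columns of length \<open>r\<close>, then \<open>j s = k r\<close>. When \<open>s\<close> and \<open>r\<close> are coprime and \<open>b < s\<close>, this
  forces \<open>k = j = 0\<close>, so \<open>(\<lambda>, \<mu>)\<close> is irreducible. The theorem is the case \<open>a = \<lambda>\<^sub>1 - 1\<close>,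
  \<open>b = \<mu>\<^sub>1\<close>, \<open>s = \<mu>\<^sub>1 + 1\<close>, \<open>r = \<lambda>\<^sub>1 + 1\<close>, with a short column of length \<open>2 \<mu>\<^sub>1 + 1 - \<lambda>\<^sub>1\<close>.
\<close>

section \<open>Dickson's lemma\<close>

lemma wellorder_seq_mono_subseq:
  fixes t :: "nat \<Rightarrow> 'b::wellorder"
  obtains h :: "nat \<Rightarrow> nat" where "strict_mono h" "mono (\<lambda>n. t (h n))"
proof -
  obtain f :: "nat \<Rightarrow> nat" where f: "strict_mono f" "monoseq (\<lambda>n. t (f n))"
    using seq_monosub by blast
  then consider (incseq) "mono (\<lambda>n. t (f n))" | (decseq) "decseq (\<lambda>n. t (f n))"
    by (auto simp: monoseq_iff)
  then show thesis
  proof cases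
    case incseq
    with f(1) show thesis by (rule that)
  next
    case decseq
    have "(LEAST v. \<exists>n. v = t (f n)) \<in> range (\<lambda>n. t (f n))"
      using LeastI_ex[of "\<lambda>v. \<exists>n. v = t (f n)"] by auto
    then obtain N where least_at_N: "t (f N) = (LEAST v. \<exists>n. v = t (f n))"
      by auto
    have least: "t (f N) \<le> t (f n)" for n
      unfolding least_at_N by (rule Least_le) blast
    have "t (f (N + n)) = t (f N)" for n
      using decseqD[OF decseq, of N "N + n"] least[of "N + n"] by simp
    moreover have "strict_mono (\<lambda>n. f (N + n))"
      using f(1) by (simp add: strict_mono_def)
    ultimately show thesis
      using that[of "\<lambda>n. f (N + n)"] by (simp add: mono_def)
  qed
qed

lemma dickson_mono_subseq:
  fixes F :: "('a \<Rightarrow> 'b::wellorder) set" and s :: "nat \<Rightarrow> 'a"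
  assumes "finite F"
  shows "\<exists>g :: nat \<Rightarrow> nat. strict_mono g \<and> (\<forall>f\<in>F. mono (\<lambda>n. f (s (g n))))"
  using assms
proof (induction F rule: finite_induct)
  case empty
  show ?case by (auto intro: exI[of _ id] simp: strict_mono_def)
next
  case (insert f F)
  then obtain g :: "nat \<Rightarrow> nat" where g: "strict_mono g" "\<forall>f\<in>F. mono (\<lambda>n. f (s (g n)))"
    by blast
  obtain h :: "nat \<Rightarrow> nat" where h: "strict_mono h" "mono (\<lambda>n. f (s (g (h n))))"
    by (rule wellorder_seq_mono_subseq)
  have "mono (\<lambda>n. f' (s (g (h n))))" if "f' \<in> F" for f'
    using g(2) that strict_mono_mono[OF h(1)] by (auto simp: mono_def)
  then show ?case
    using h strict_mono_o[OF g(1) h(1)] by (intro exI[of _ "g \<circ> h"]) (auto simp: o_def)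
qed

lemma dickson_finite_antichain:
  fixes F :: "('a \<Rightarrow> 'b::wellorder) set"
  assumes "finite F"
    and antichain: "\<And>x y. x \<in> A \<Longrightarrow> y \<in> A \<Longrightarrow> (\<And>f. f \<in> F \<Longrightarrow> f x \<le> f y) \<Longrightarrow> x = y"
  shows "finite A"
proof (rule ccontr)
  assume "infinite A"
  then obtain s :: "nat \<Rightarrow> 'a" where s: "inj s" "range s \<subseteq> A"
    using infinite_countable_subset by blast
  obtain g :: "nat \<Rightarrow> nat" where g: "strict_mono g" "\<forall>f\<in>F. mono (\<lambda>n. f (s (g n)))"
    using dickson_mono_subseq[OF assms(1)] by blast
  have "f (s (g 0)) \<le> f (s (g 1))" if "f \<in> F" for f
    using g(2) that by (simp add: mono_def)
  then have "s (g 0) = s (g 1)"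
    using s(2) by (intro antichain) auto
  then show False
    using s(1) strict_monoD[OF g(1), of 0 1] by (simp add: inj_eq)
qed

section \<open>Irreducible elements of commutative monoids\<close>

definition irreducibles :: "'a::comm_monoid_add set \<Rightarrow> 'a set" where
  "irreducibles M = {x \<in> M. x \<noteq> 0 \<and> (\<forall>y\<in>M. \<forall>z\<in>M. x = y + z \<longrightarrow> y = 0 \<or> z = 0)}"

lemma irreduciblesD:
  assumes "x \<in> irreducibles M"
  shows "x \<in> M" "x \<noteq> 0" "\<And>y z. y \<in> M \<Longrightarrow> z \<in> M \<Longrightarrow> x = y + z \<Longrightarrow> y = 0 \<or> z = 0"
  using assms by (auto simp: irreducibles_def)

locale add_submonoid =
  fixes M :: "'a::comm_monoid_add set"
  assumes zero_closed: "0 \<in> M"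
    and add_closed: "x \<in> M \<Longrightarrow> y \<in> M \<Longrightarrow> x + y \<in> M"
begin

lemma sum_closed: "(\<And>i. i \<in> I \<Longrightarrow> g i \<in> M) \<Longrightarrow> sum g I \<in> M"
  by (induction I rule: infinite_finite_induct) (auto intro: zero_closed add_closed)

lemma irreducible_sum_eq_summand:
  assumes "sum g I \<in> irreducibles M" "\<And>i. i \<in> I \<Longrightarrow> g i \<in> M"
  shows "\<exists>i\<in>I. sum g I = g i"
  using assms
proof (induction I rule: infinite_finite_induct)
  case (insert i I)
  have "g i \<in> M" "sum g I \<in> M"
    using insert.prems(2) by (auto intro: sum_closed)
  then have "g i = 0 \<or> sum g I = 0"
    using irreduciblesD(3)[OF insert.prems(1)] insert.hyps by simp
  then show ?case
    using insert by auto
qed (auto simp: irreducibles_def)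

lemma subset_of_irreducibles_subset:
  fixes degree :: "'a \<Rightarrow> nat"
  assumes "add_submonoid S" and irr: "irreducibles M \<subseteq> S"
    and degree_add: "\<And>x y. x \<in> M \<Longrightarrow> y \<in> M \<Longrightarrow> degree (x + y) = degree x + degree y"
    and degree_pos: "\<And>x. x \<in> M \<Longrightarrow> x \<noteq> 0 \<Longrightarrow> 0 < degree x"
  shows "M \<subseteq> S"
proof
  interpret S: add_submonoid S by fact
  fix x assume "x \<in> M"
  then show "x \<in> S"
  proof (induction "degree x" arbitrary: x rule: less_induct)
    case less
    then consider (zero) "x = 0" | (irreducible) "x \<in> irreducibles M"
      | (sum) y z where "y \<in> M" "z \<in> M" "x = y + z" "y \<noteq> 0" "z \<noteq> 0"
      by (auto simp: irreducibles_def)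
    then show ?case
    proof cases
      case (sum y z)
      then have "degree y < degree x" "degree z < degree x"
        using degree_add degree_pos by simp_all
      then show ?thesis
        using less.hyps sum by (auto intro: S.add_closed)
    qed (use irr S.zero_closed in auto)
  qed
qed

end

interpretation Nats: add_submonoid \<nat>
  by unfold_locales simp_all

lemma finite_irreducibles:
  fixes M :: "'a::ab_group_add set" and F :: "('a \<Rightarrow> 'b::wellorder) set"
  assumes "finite F"
    and diff: "\<And>x y. x \<in> M \<Longrightarrow> y \<in> M \<Longrightarrow> (\<And>f. f \<in> F \<Longrightarrow> f x \<le> f y) \<Longrightarrow> y - x \<in> M"
  shows "finite (irreducibles M)"
  using assms(1)
proof (rule dickson_finite_antichain)
  fix x y assume irr: "x \<in> irreducibles M" "y \<in> irreducibles M"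
    and F_mono: "\<And>f. f \<in> F \<Longrightarrow> f x \<le> f y"
  have "x \<in> M" "y - x \<in> M"
    using irr diff[of x y] F_mono by (auto dest: irreduciblesD(1))
  moreover have "y = x + (y - x)" by simp
  ultimately have "x = 0 \<or> y - x = 0"
    by (rule irreduciblesD(3)[OF irr(2)])
  then show "x = y"
    using irreduciblesD(2)[OF irr(1)] by simp
qed

section \<open>Hilbert bases\<close>

definition nat_span :: "'a::real_vector set \<Rightarrow> 'a set" where
  "nat_span H = {x. \<exists>c :: 'a \<Rightarrow> nat. x = (\<Sum>h\<in>H. real (c h) *\<^sub>R h)}"

lemma add_submonoid_nat_span: "add_submonoid (nat_span H)"
proof
  show "0 \<in> nat_span H"
    unfolding nat_span_def by (intro CollectI exI[of _ "\<lambda>_. 0"]) simp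
  fix x y assume "x \<in> nat_span H" "y \<in> nat_span H"
  then obtain c e :: "'a \<Rightarrow> nat"
    where "x = (\<Sum>h\<in>H. real (c h) *\<^sub>R h)" "y = (\<Sum>h\<in>H. real (e h) *\<^sub>R h)"
    by (auto simp: nat_span_def)
  then show "x + y \<in> nat_span H"
    unfolding nat_span_def
    by (intro CollectI exI[of _ "\<lambda>h. c h + e h"]) (simp add: scaleR_add_left sum.distrib)
qed

lemma subset_nat_span:
  assumes "finite H"
  shows "H \<subseteq> nat_span H"
proof
  fix x assume "x \<in> H"
  have "(\<Sum>h\<in>H. real (of_bool (h = x)) *\<^sub>R h) = (\<Sum>h\<in>H. if h = x then h else 0)"
    by (intro sum.cong) auto
  also have "\<dots> = x"
    using assms \<open>x \<in> H\<close> by simp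
  finally show "x \<in> nat_span H"
    unfolding nat_span_def by (intro CollectI exI[of _ "\<lambda>h. of_bool (h = x)"]) simp
qed

lemma mem_of_irreducible_mem_nat_span:
  assumes "add_submonoid M" and irr: "x \<in> irreducibles M" and "H \<subseteq> M" and "x \<in> nat_span H"
  shows "x \<in> H"
proof -
  interpret add_submonoid M by fact
  obtain c :: "'a \<Rightarrow> nat" where x: "x = (\<Sum>h\<in>H. real (c h) *\<^sub>R h)"
    using assms(4) by (auto simp: nat_span_def)
  have multiple: "real (c h) *\<^sub>R h = (\<Sum>i<c h. h)" for h
    by (simp add: sum_constant_scaleR)
  have "\<exists>h\<in>H. x = (\<Sum>i<c h. h)"
    using irr \<open>H \<subseteq> M\<close> unfolding x multiple
    by (intro irreducible_sum_eq_summand sum_closed) auto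
  then obtain h where h: "h \<in> H" "x = (\<Sum>i<c h. h)" ..
  then show ?thesis
    using irreducible_sum_eq_summand[of "\<lambda>_. h" "{..<c h}"] irr \<open>H \<subseteq> M\<close> by auto
qed

lemma finite_generating_set_iff:
  "finite_generating_set C H
     \<longleftrightarrow> finite H \<and> H \<subseteq> integer_points C \<and> integer_points C \<subseteq> nat_span H"
  by (auto simp: finite_generating_set_def nat_span_def)

lemma hilbert_basis_eq_irreducibles:
  assumes "add_submonoid (integer_points C)"
    and gen: "finite_generating_set C (irreducibles (integer_points C))"
  shows "hilbert_basis C = irreducibles (integer_points C)"
proof -
  have "irreducibles (integer_points C) \<subseteq> H" if "finite_generating_set C H" for H
    using that mem_of_irreducible_mem_nat_span[OF assms(1)]
    by (auto simp: finite_generating_set_iff dest: irreduciblesD(1))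
  then show ?thesis
    unfolding hilbert_basis_def using gen by (intro the_equality) blast+
qed

section \<open>Lattice points of pointed cones\<close>

locale pointed_lattice_cone =
  fixes V :: "'a::real_vector set" and F :: "('a \<Rightarrow> real) set"
  assumes finite_F: "finite F"
    and subspace_V: "subspace V"
    and linear_F: "f \<in> F \<Longrightarrow> linear f"
    and pointed: "x \<in> V \<Longrightarrow> (\<And>f. f \<in> F \<Longrightarrow> f x = 0) \<Longrightarrow> x = 0"
begin

definition cone :: "'a set" where
  "cone = {x \<in> V. \<forall>f\<in>F. 0 \<le> f x}"

definition points :: "'a set" where
  "points = {x \<in> V. \<forall>f\<in>F. f x \<in> \<nat>}"

definition degree :: "'a \<Rightarrow> nat" where
  "degree x = (\<Sum>f\<in>F. nat \<lfloor>f x\<rfloor>)"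

lemma convex_cone: "convex cone"
proof -
  have "convex (f -` {0..})" if "f \<in> F" for f
    using linear_F[OF that] by (intro convex_linear_vimage) auto
  moreover have "cone = V \<inter> (\<Inter>f\<in>F. f -` {0..})"
    by (auto simp: cone_def)
  ultimately show ?thesis
    using subspace_imp_convex[OF subspace_V] by (auto intro!: convex_Int convex_INT)
qed

lemma points_eq_integral_cone: "points = {x \<in> cone. \<forall>f\<in>F. f x \<in> \<int>}"
  by (auto simp: points_def cone_def Nats_altdef2)

sublocale add_submonoid points
proof
  have "f 0 \<in> \<nat>" if "f \<in> F" for f
    using linear_0[OF linear_F[OF that]] by simp
  then show "0 \<in> points"
    using subspace_0[OF subspace_V] by (simp add: points_def)
  fix x y assume xy: "x \<in> points" "y \<in> points"
  have "f (x + y) \<in> \<nat>" if "f \<in> F" for f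
    using that xy linear_add[OF linear_F[OF that]] by (simp add: points_def)
  then show "x + y \<in> points"
    using xy subspace_add[OF subspace_V] by (simp add: points_def)
qed

lemma nat_floor_functional: "x \<in> points \<Longrightarrow> f \<in> F \<Longrightarrow> real (nat \<lfloor>f x\<rfloor>) = f x"
  by (force simp: points_def elim: Nats_cases)

lemma diff_closed:
  assumes "x \<in> points" "y \<in> points" "\<And>f. f \<in> F \<Longrightarrow> f x \<le> f y"
  shows "y - x \<in> points"
proof -
  have "f (y - x) \<in> \<nat>" if "f \<in> F" for f
    using that assms linear_diff[OF linear_F[OF that]] by (simp add: points_def)
  then show ?thesis
    using assms subspace_diff[OF subspace_V] by (simp add: points_def)
qed

lemma finite_irreducibles_points: "finite (irreducibles points)"
proof (rule finite_irreducibles)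
  show "finite ((\<lambda>f x. nat \<lfloor>f x\<rfloor>) ` F)"
    using finite_F by simp
  fix x y assume xy: "x \<in> points" "y \<in> points"
    and F_mono: "\<And>g. g \<in> (\<lambda>f x. nat \<lfloor>f x\<rfloor>) ` F \<Longrightarrow> g x \<le> g y"
  have "f x \<le> f y" if "f \<in> F" for f
  proof -
    have "real (nat \<lfloor>f x\<rfloor>) \<le> real (nat \<lfloor>f y\<rfloor>)"
      unfolding of_nat_le_iff using that by (intro F_mono imageI)
    then show ?thesis
      by (simp only: nat_floor_functional[OF xy(1) that] nat_floor_functional[OF xy(2) that])
  qed
  with xy show "y - x \<in> points"
    by (rule diff_closed)
qed

lemma degree_add:
  assumes "x \<in> points" "y \<in> points"
  shows "degree (x + y) = degree x + degree y"
proof -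
  have "nat \<lfloor>f (x + y)\<rfloor> = nat \<lfloor>f x\<rfloor> + nat \<lfloor>f y\<rfloor>" if "f \<in> F" for f
  proof -
    have "real (nat \<lfloor>f (x + y)\<rfloor>) = real (nat \<lfloor>f x\<rfloor>) + real (nat \<lfloor>f y\<rfloor>)"
      using that assms add_closed linear_add[OF linear_F] by (simp add: nat_floor_functional)
    then show ?thesis by linarith
  qed
  then show ?thesis
    by (simp add: degree_def sum.distrib)
qed

lemma degree_pos:
  assumes "x \<in> points" "x \<noteq> 0"
  shows "0 < degree x"
proof (rule ccontr)
  assume "\<not> 0 < degree x"
  then have "real (nat \<lfloor>f x\<rfloor>) = 0" if "f \<in> F" for f
    using that finite_F by (simp add: degree_def)
  then have "f x = 0" if "f \<in> F" for f
    using that nat_floor_functional[OF assms(1)] by metis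
  then show False
    using pointed assms by (simp add: points_def)
qed

lemma points_subset_nat_span_irreducibles: "points \<subseteq> nat_span (irreducibles points)"
  using add_submonoid_nat_span subset_nat_span[OF finite_irreducibles_points] degree_add degree_pos
  by (rule subset_of_irreducibles_subset)

end

lemma hilbert_basis_pointed_lattice_cone:
  assumes "pointed_lattice_cone V F" "integer_points C = pointed_lattice_cone.points V F"
  shows "hilbert_basis C = irreducibles (integer_points C)"
proof -
  interpret pointed_lattice_cone V F by fact
  have "finite_generating_set C (irreducibles points)"
    using finite_irreducibles_points points_subset_nat_span_irreducibles
    by (auto simp: finite_generating_set_iff assms(2) dest: irreduciblesD(1))
  then show ?thesis
    using hilbert_basis_eq_irreducibles add_submonoid_axioms by (simp add: assms(2))
qed

section \<open>Partitions as multisets of columns\<close>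

definition young_column :: "nat \<Rightarrow> (nat \<Rightarrow>\<^sub>0 real)" where
  "young_column k = (\<Sum>i=1..k. Poly_Mapping.single i 1)"

definition column_count :: "(nat \<Rightarrow>\<^sub>0 real) \<Rightarrow> nat \<Rightarrow> real" where
  "column_count p i = Poly_Mapping.lookup p i - Poly_Mapping.lookup p (Suc i)"

definition partial_sum :: "(nat \<Rightarrow>\<^sub>0 'a::comm_monoid_add) \<Rightarrow> nat \<Rightarrow> 'a" where
  "partial_sum p k = (\<Sum>i=1..k. Poly_Mapping.lookup p i)"

lemma lookup_scaleR: "Poly_Mapping.lookup (c *\<^sub>R p) i = c *\<^sub>R Poly_Mapping.lookup p i"
proof -
  have "finite {i. c *\<^sub>R Poly_Mapping.lookup p i \<noteq> 0}"
    by (rule finite_subset[OF _ finite_keys[of p]]) (auto simp: in_keys_iff)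
  then show ?thesis by (simp add: scaleR_poly_mapping_def)
qed

lemma lookup_eq_0: "Poly_Mapping.keys p \<subseteq> S \<Longrightarrow> i \<notin> S \<Longrightarrow> Poly_Mapping.lookup p i = 0"
  by (meson in_keys_iff subsetD)

lemma linear_lookup: "linear (\<lambda>p. Poly_Mapping.lookup p i)"
  by (rule linearI) (simp_all add: lookup_add lookup_scaleR)

lemma linear_compose_fst: "linear f \<Longrightarrow> linear (\<lambda>z. f (fst z))"
  using linear_compose[OF linear_fst] by (simp add: o_def)

lemma linear_compose_snd: "linear f \<Longrightarrow> linear (\<lambda>z. f (snd z))"
  using linear_compose[OF linear_snd] by (simp add: o_def)

lemma linear_column_count: "linear (\<lambda>p. column_count p i)"
  unfolding column_count_def by (intro linear_compose_sub linear_lookup)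

lemma linear_partial_sum: "linear (\<lambda>p :: nat \<Rightarrow>\<^sub>0 'a::real_vector. partial_sum p k)"
  unfolding partial_sum_def by (intro linear_compose_sum ballI linear_lookup)

lemma subspace_keys_subset: "subspace {p :: 'a \<Rightarrow>\<^sub>0 'b::real_vector. Poly_Mapping.keys p \<subseteq> S}"
proof -
  have "{p :: 'a \<Rightarrow>\<^sub>0 'b. Poly_Mapping.keys p \<subseteq> S}
      = (\<Inter>i\<in>- S. {p. Poly_Mapping.lookup p i = 0})"
    by (auto simp: in_keys_iff)
  then show ?thesis
    by (auto intro!: subspace_Inter linear_subspace_kernel linear_lookup)
qed

lemma lookup_young_column: "Poly_Mapping.lookup (young_column k) i = of_bool (i \<in> {1..k})"
  by (simp add: young_column_def lookup_sum lookup_single when_def)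

lemma column_count_young_column: "1 \<le> i \<Longrightarrow> column_count (young_column k) i = of_bool (i = k)"
  by (auto simp: column_count_def lookup_young_column)

lemma partial_sum_young_column: "partial_sum (young_column j) k = real (min j k)"
proof -
  have "partial_sum (young_column j) k = real (card ({1..k} \<inter> {1..j}))"
    by (simp only: partial_sum_def lookup_young_column sum_of_bool_eq finite_atLeastAtMost
        Collect_mem_eq)
  also have "{1..k} \<inter> {1..j} = {1..min j k}"
    by auto
  finally show ?thesis by simp
qed

lemma eq_sum_young_columns:
  assumes "Poly_Mapping.keys p \<subseteq> {1..r}"
  shows "p = (\<Sum>k=1..r. column_count p k *\<^sub>R young_column k)"
proof (rule poly_mapping_eqI)
  fix i
  have "Poly_Mapping.lookup p i = (\<Sum>k\<in>{1..r} \<inter> {k. i \<in> {1..k}}. column_count p k)"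
  proof (cases "i \<in> {1..r}")
    case True
    then have "{1..r} \<inter> {k. i \<in> {1..k}} = {i..r}" "i \<le> Suc r" by auto
    moreover have "Poly_Mapping.lookup p (Suc r) = 0"
      using assms by (rule lookup_eq_0) simp
    ultimately show ?thesis
      using sum_Suc_diff[of i r "\<lambda>k. - Poly_Mapping.lookup p k"] by (simp add: column_count_def)
  next
    case False
    then have "{1..r} \<inter> {k. i \<in> {1..k}} = {}" by auto
    with lookup_eq_0[OF assms False] show ?thesis by simp
  qed
  also have "\<dots> = Poly_Mapping.lookup (\<Sum>k=1..r. column_count p k *\<^sub>R young_column k) i"
    by (simp add: sum.inter_restrict lookup_sum lookup_scaleR lookup_young_column of_bool_def
        if_distrib cong: if_cong)
  finally show "Poly_Mapping.lookup p i
      = Poly_Mapping.lookup (\<Sum>k=1..r. column_count p k *\<^sub>R young_column k) i" .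
qed

lemma lookup_in_Nats:
  assumes "Poly_Mapping.keys p \<subseteq> {1..r}" "\<And>k. k \<in> {1..r} \<Longrightarrow> column_count p k \<in> \<nat>"
  shows "Poly_Mapping.lookup p i \<in> \<nat>"
  using assms(2)
  by (subst eq_sum_young_columns[OF assms(1)])
    (auto simp: lookup_sum lookup_scaleR lookup_young_column intro!: Nats.sum_closed)

lemma eq_scaleR_young_column:
  assumes "Poly_Mapping.keys p \<subseteq> {1..r}" "s \<in> {1..r}"
    and "\<And>k. k \<in> {1..r} - {s} \<Longrightarrow> column_count p k = 0"
  shows "p = column_count p s *\<^sub>R young_column s"
proof -
  have "(\<Sum>k=1..r. column_count p k *\<^sub>R young_column k)
      = (\<Sum>k\<in>{s}. column_count p k *\<^sub>R young_column k)"
    using assms(2,3) by (intro sum.mono_neutral_right) auto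
  then show ?thesis
    using eq_sum_young_columns[OF assms(1)] by simp
qed

section \<open>Integer points of the Kostka cone\<close>

definition kostka_space :: "nat \<Rightarrow> point set" where
  "kostka_space r = {z. Poly_Mapping.keys (fst z) \<subseteq> {1..r} \<and> Poly_Mapping.keys (snd z) \<subseteq> {1..r}
     \<and> partial_sum (fst z) r = partial_sum (snd z) r}"

definition kostka_functionals :: "nat \<Rightarrow> (point \<Rightarrow> real) set" where
  "kostka_functionals r =
     (\<lambda>i z. column_count (fst z) i) ` {1..r} \<union> (\<lambda>i z. column_count (snd z) i) ` {1..r}
   \<union> (\<lambda>k z. partial_sum (fst z) k - partial_sum (snd z) k) ` {..r}"

lemma subspace_kostka_space: "subspace (kostka_space r)"
proof -
  let ?K = "{p :: nat \<Rightarrow>\<^sub>0 real. Poly_Mapping.keys p \<subseteq> {1..r}}"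
  let ?E = "{z :: point. partial_sum (fst z) r - partial_sum (snd z) r = 0}"
  have "kostka_space r = (?K \<times> ?K) \<inter> ?E"
    by (simp add: kostka_space_def set_eq_iff mem_Times_iff)
  moreover have "subspace (?K \<times> ?K)"
    by (intro subspace_Times subspace_keys_subset)
  moreover have "subspace ?E"
    by (intro linear_subspace_kernel linear_compose_sub linear_compose_fst linear_compose_snd
        linear_partial_sum)
  ultimately show ?thesis
    by (simp only: subspace_inter)
qed

lemma linear_kostka_functionals: "f \<in> kostka_functionals r \<Longrightarrow> linear f"
  unfolding kostka_functionals_def
  by (auto intro!: linear_compose_sub linear_compose_fst linear_compose_snd linear_column_count
      linear_partial_sum)

interpretation kostka: pointed_lattice_cone "kostka_space r" "kostka_functionals r" for r
proof (rule pointed_lattice_cone.intro)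
  show "finite (kostka_functionals r)"
    by (simp add: kostka_functionals_def)
  fix z :: point
  assume z: "z \<in> kostka_space r" and zero: "\<And>f. f \<in> kostka_functionals r \<Longrightarrow> f z = 0"
  have "column_count (fst z) k = 0" "column_count (snd z) k = 0" if "k \<in> {1..r}" for k
    using that zero[of "\<lambda>z. column_count (fst z) k"] zero[of "\<lambda>z. column_count (snd z) k"]
    by (auto simp: kostka_functionals_def)
  then have "fst z = 0" "snd z = 0"
    using z eq_sum_young_columns[of "fst z" r] eq_sum_young_columns[of "snd z" r]
    by (simp_all add: kostka_space_def)
  then show "z = 0"
    by (simp add: prod_eq_iff)
qed (fact subspace_kostka_space linear_kostka_functionals)+

lemma mem_kostka_points_iff:
  "z \<in> kostka.points r \<longleftrightarrow>
     Poly_Mapping.keys (fst z) \<subseteq> {1..r} \<and> Poly_Mapping.keys (snd z) \<subseteq> {1..r}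
     \<and> partial_sum (fst z) r = partial_sum (snd z) r
     \<and> (\<forall>i\<in>{1..r}. column_count (fst z) i \<in> \<nat> \<and> column_count (snd z) i \<in> \<nat>)
     \<and> (\<forall>k\<le>r. partial_sum (fst z) k - partial_sum (snd z) k \<in> \<nat>)"
  unfolding kostka.points_def unfolding kostka_space_def kostka_functionals_def by auto

lemma lookup_map_real:
  "Poly_Mapping.lookup (Poly_Mapping.map real p) i = real (Poly_Mapping.lookup p i)"
  by (simp add: map.rep_eq when_def)

lemma ex_map_real_eq:
  assumes "\<And>i. Poly_Mapping.lookup x i \<in> \<nat>"
  shows "\<exists>p. x = Poly_Mapping.map real p"
proof -
  have "real (nat \<lfloor>Poly_Mapping.lookup x i\<rfloor>) = Poly_Mapping.lookup x i" for i
    using assms[of i] by (auto elim: Nats_cases)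
  moreover have "Poly_Mapping.lookup (Poly_Mapping.map (\<lambda>t. nat \<lfloor>t\<rfloor>) x) i
      = nat \<lfloor>Poly_Mapping.lookup x i\<rfloor>" for i
    by (simp add: map.rep_eq when_def)
  ultimately have "x = Poly_Mapping.map real (Poly_Mapping.map (\<lambda>t. nat \<lfloor>t\<rfloor>) x)"
    by (intro poly_mapping_eqI) (simp only: lookup_map_real)
  then show ?thesis ..
qed

lemma of_nat_diff_in_Nats_iff:
  "(of_nat a - of_nat b :: 'a::linordered_idom) \<in> \<nat> \<longleftrightarrow> b \<le> a"
  by (auto simp: Nats_altdef2)

lemma partial_sum_map_real: "partial_sum (Poly_Mapping.map real p) k = real (partial_sum p k)"
  by (simp add: partial_sum_def lookup_map_real)

lemma mem_Par_iff:
  "p \<in> Par r n \<longleftrightarrow> Poly_Mapping.keys p \<subseteq> {1..r} \<and> partial_sum p r = n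
     \<and> (\<forall>i\<in>{1..r}. column_count (Poly_Mapping.map real p) i \<in> \<nat>)"
proof -
  have "(\<forall>i\<in>{1..r}. Poly_Mapping.lookup p (Suc i) \<le> Poly_Mapping.lookup p i)
      \<longleftrightarrow> (\<forall>i\<in>{1..<r}. Poly_Mapping.lookup p (Suc i) \<le> Poly_Mapping.lookup p i)"
    if "Poly_Mapping.keys p \<subseteq> {1..r}"
    using lookup_eq_0[OF that, of "Suc r"] by (force simp: le_less)
  then show ?thesis
    by (auto simp: Par_def partial_sum_def column_count_def lookup_map_real of_nat_diff_in_Nats_iff)
qed

lemma map_real_mem_kostka_points_iff:
  "(Poly_Mapping.map real p, Poly_Mapping.map real q) \<in> kostka.points r
     \<longleftrightarrow> (\<exists>n. p \<in> Par r n \<and> q \<in> Par r n \<and> dominates r p q)"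
proof -
  have "Poly_Mapping.keys (Poly_Mapping.map real s) = Poly_Mapping.keys s" for s :: "nat \<Rightarrow>\<^sub>0 nat"
    by (auto simp: in_keys_iff lookup_map_real)
  moreover have "dominates r p q \<longleftrightarrow> (\<forall>k\<le>r. partial_sum q k \<le> partial_sum p k)"
    by (simp add: dominates_def partial_sum_def)
  ultimately show ?thesis
    by (auto simp: mem_kostka_points_iff mem_Par_iff partial_sum_map_real of_nat_diff_in_Nats_iff)
qed

lemma kostka_points_lookup_in_Nats:
  assumes "z \<in> kostka.points r"
  shows "Poly_Mapping.lookup (fst z) i \<in> \<nat>" "Poly_Mapping.lookup (snd z) i \<in> \<nat>"
  using assms by (auto simp: mem_kostka_points_iff intro!: lookup_in_Nats[of _ r])

lemma kostka_points_subset_kostka_cone: "kostka.points r \<subseteq> kostka_cone r"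
proof
  fix z assume z: "z \<in> kostka.points r"
  obtain p q where "fst z = Poly_Mapping.map real p" "snd z = Poly_Mapping.map real q"
    using ex_map_real_eq kostka_points_lookup_in_Nats[OF z] by metis
  then have "z = (Poly_Mapping.map real p, Poly_Mapping.map real q)"
    by (simp add: prod_eq_iff)
  with z show "z \<in> kostka_cone r"
    unfolding kostka_cone_def using map_real_mem_kostka_points_iff by (intro hull_inc) blast
qed

lemma kostka_cone_subset: "kostka_cone r \<subseteq> kostka.cone r"
  unfolding kostka_cone_def
proof (rule hull_minimal)
  show "{(Poly_Mapping.map real p, Poly_Mapping.map real q) | p q.
      \<exists>n. p \<in> Par r n \<and> q \<in> Par r n \<and> dominates r p q} \<subseteq> kostka.cone r"
    using map_real_mem_kostka_points_iff kostka.points_eq_integral_cone by blast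
qed (rule kostka.convex_cone)

lemma integer_points_kostka_cone: "integer_points (kostka_cone r) = kostka.points r"
proof (intro equalityI subsetI)
  fix z assume z: "z \<in> integer_points (kostka_cone r)"
  then have "f z \<in> \<int>" if "f \<in> kostka_functionals r" for f
    using that unfolding integer_points_def kostka_functionals_def column_count_def partial_sum_def
    by (auto intro!: Ints_diff Ints_sum)
  with z show "z \<in> kostka.points r"
    using kostka_cone_subset by (auto simp: kostka.points_eq_integral_cone integer_points_def)
next
  fix z assume z: "z \<in> kostka.points r"
  then show "z \<in> integer_points (kostka_cone r)"
    using kostka_points_subset_kostka_cone kostka_points_lookup_in_Nats[OF z] Nats_subset_Ints
    by (auto simp: integer_points_def)
qed

lemma hilbert_basis_kostka_cone: "hilbert_basis (kostka_cone r) = irreducibles (kostka.points r)"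
  using hilbert_basis_pointed_lattice_cone[OF kostka.pointed_lattice_cone_axioms]
  by (simp add: integer_points_kostka_cone)

section \<open>Irreducible pairs\<close>

definition column_pair :: "nat \<Rightarrow> nat \<Rightarrow> nat \<Rightarrow> nat \<Rightarrow> nat \<Rightarrow> point" where
  "column_pair a s d b r = (real a *\<^sub>R young_column s + young_column d, real b *\<^sub>R young_column r)"

lemma column_count_column_pair:
  assumes "1 \<le> i"
  shows "column_count (fst (column_pair a s d b r)) i = real a * of_bool (i = s) + of_bool (i = d)"
    and "column_count (snd (column_pair a s d b r)) i = real b * of_bool (i = r)"
  using assms
  by (simp_all add: column_pair_def column_count_young_column linear_add[OF linear_column_count]
      linear_scale[OF linear_column_count])

lemma partial_sum_column_pair:
  "partial_sum (fst (column_pair a s d b r)) k = real (a * min s k + min d k)"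
  "partial_sum (snd (column_pair a s d b r)) k = real (b * min r k)"
  by (simp_all add: column_pair_def partial_sum_young_column linear_add[OF linear_partial_sum]
      linear_scale[OF linear_partial_sum])

lemma rectangle_dominated:
  fixes a s d b r k :: nat
  assumes "d \<le> s" "s \<le> r" "a * s + d = b * r" "k \<le> r"
  shows "b * k \<le> a * min s k + min d k"
proof (cases "s \<le> k")
  case True
  then have "a * min s k + min d k = b * r"
    using assms by (simp add: min_absorb1)
  then show ?thesis
    using \<open>k \<le> r\<close> by simp
next
  case False
  have "r * (b * k) = (a * s + d) * k"
    using assms(3) by simp
  also have "\<dots> = a * k * s + min d k * max d k"
    by (simp add: min_def max_def algebra_simps)
  also have "\<dots> \<le> a * k * r + min d k * r"
    using assms by (intro add_mono mult_left_mono) auto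
  also have "\<dots> = r * (a * min s k + min d k)"
    using False by (simp add: algebra_simps)
  finally show ?thesis
    using False \<open>s \<le> r\<close> by simp
qed

lemma column_pair_in_kostka_points:
  assumes "d \<le> s" "s \<le> r" "a * s + d = b * r"
  shows "column_pair a s d b r \<in> kostka.points r"
proof -
  let ?z = "column_pair a s d b r"
  have "Poly_Mapping.keys (fst ?z) \<subseteq> {1..r}" "Poly_Mapping.keys (snd ?z) \<subseteq> {1..r}"
    using assms
    by (auto simp: column_pair_def in_keys_iff lookup_add lookup_scaleR lookup_young_column
        of_bool_def split: if_splits)
  moreover have "partial_sum (fst ?z) r = partial_sum (snd ?z) r"
    using assms by (simp add: partial_sum_column_pair min_absorb1)
  moreover have "b * min r k \<le> a * min s k + min d k" if "k \<le> r" for k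
    using rectangle_dominated[OF assms that] that by (simp add: min_absorb2)
  ultimately show ?thesis
    unfolding mem_kostka_points_iff
    by (auto simp: column_count_column_pair partial_sum_column_pair of_nat_diff_in_Nats_iff
        simp del: of_nat_add of_nat_mult)
qed

lemma column_pair_summand_rectangular:
  assumes "s \<in> {1..r}" and u: "u \<in> kostka.points r" and v: "v \<in> kostka.points r"
    and uv: "column_pair a s d b r = u + v" and no_short_column: "column_count (fst u) d = 0"
  shows "\<exists>j k. k \<le> b \<and> u = (real j *\<^sub>R young_column s, real k *\<^sub>R young_column r)"
proof -
  have count: "column_count (fst u) i + column_count (fst v) i
        = real a * of_bool (i = s) + of_bool (i = d)"
      "column_count (snd u) i + column_count (snd v) i = real b * of_bool (i = r)"
    if "i \<in> {1..r}" for i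
    using that column_count_column_pair[of i a s d b r]
    by (simp_all add: uv linear_add[OF linear_column_count])
  have nonneg: "0 \<le> column_count (fst z) i" "0 \<le> column_count (snd z) i"
    if "z \<in> kostka.points r" "i \<in> {1..r}" for z i
    using that by (auto simp: mem_kostka_points_iff Nats_altdef2)
  have keys: "Poly_Mapping.keys (fst u) \<subseteq> {1..r}" "Poly_Mapping.keys (snd u) \<subseteq> {1..r}"
    using u by (simp_all add: mem_kostka_points_iff)
  have "r \<in> {1..r}"
    using assms(1) by simp
  have "column_count (fst u) i = 0" if "i \<in> {1..r} - {s}" for i
    using that count(1)[of i] nonneg(1)[OF u, of i] nonneg(1)[OF v, of i] no_short_column
    by (cases "i = d") auto
  then have fst_u: "fst u = column_count (fst u) s *\<^sub>R young_column s"
    by (rule eq_scaleR_young_column[OF keys(1) assms(1)])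
  have "column_count (snd u) i = 0" if "i \<in> {1..r} - {r}" for i
    using that count(2)[of i] nonneg(2)[OF u, of i] nonneg(2)[OF v, of i] by auto
  then have snd_u: "snd u = column_count (snd u) r *\<^sub>R young_column r"
    by (rule eq_scaleR_young_column[OF keys(2) \<open>r \<in> {1..r}\<close>])
  have "column_count (fst u) s \<in> \<nat>" "column_count (snd u) r \<in> \<nat>"
    using u assms(1) \<open>r \<in> {1..r}\<close> unfolding mem_kostka_points_iff by blast+
  then obtain j k
    where multiplicities: "column_count (fst u) s = real j" "column_count (snd u) r = real k"
    by (metis Nats_cases)
  have "k \<le> b"
    using count(2)[OF \<open>r \<in> {1..r}\<close>] nonneg(2)[OF v \<open>r \<in> {1..r}\<close>] multiplicities(2) by simp
  with fst_u snd_u multiplicities show ?thesis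
    by (metis prod.collapse)
qed

lemma rectangular_kostka_point_eq_0:
  assumes "k < s" "s \<le> r" "coprime s r"
    and "(real j *\<^sub>R young_column s, real k *\<^sub>R young_column r) \<in> kostka.points r"
  shows "j = 0 \<and> k = 0"
proof -
  have "real (j * s) = real (k * r)"
    using assms(2,4)
    by (simp add: mem_kostka_points_iff linear_scale[OF linear_partial_sum] partial_sum_young_column
        min_absorb1)
  then have size_eq: "j * s = k * r"
    by (simp only: of_nat_eq_iff)
  then have "s dvd k"
    using \<open>coprime s r\<close> coprime_dvd_mult_left_iff by (metis dvd_triv_right)
  with \<open>k < s\<close> have "k = 0"
    by (auto dest: dvd_imp_le)
  with size_eq \<open>k < s\<close> show ?thesis
    by simp
qed

lemma column_pair_summand_eq_0:
  assumes "b < s" "s \<le> r" "coprime s r"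
    and "u \<in> kostka.points r" "v \<in> kostka.points r" "column_pair a s d b r = u + v"
    and "column_count (fst u) d = 0"
  shows "u = 0"
proof -
  obtain j k where "k \<le> b" and u: "u = (real j *\<^sub>R young_column s, real k *\<^sub>R young_column r)"
    using column_pair_summand_rectangular[OF _ assms(4-7)] assms(1,2) by auto
  then have "j = 0 \<and> k = 0"
    using rectangular_kostka_point_eq_0[of k s r j] assms(1-4) by simp
  then show ?thesis
    by (simp add: u zero_prod_def)
qed

lemma column_pair_irreducible:
  assumes "0 < d" "d < s" "s \<le> r" "b < s" "coprime s r" "a * s + d = b * r"
  shows "column_pair a s d b r \<in> irreducibles (kostka.points r)"
proof -
  let ?z = "column_pair a s d b r"
  have short_column: "d \<in> {1..r}" "column_count (fst ?z) d = 1"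
    using assms by (auto simp: column_count_column_pair)
  have "u = 0 \<or> v = 0" if uv: "u \<in> kostka.points r" "v \<in> kostka.points r" "?z = u + v" for u v
  proof -
    have "column_count (fst u) d \<in> \<nat>" "column_count (fst v) d \<in> \<nat>"
      using uv(1,2) short_column(1) by (auto simp: mem_kostka_points_iff)
    moreover have "column_count (fst u) d + column_count (fst v) d = 1"
      using short_column(2) by (simp add: uv(3) linear_add[OF linear_column_count])
    ultimately have "column_count (fst u) d = 0 \<or> column_count (fst v) d = 0"
      by (auto elim!: Nats_cases simp flip: of_nat_add)
    moreover have "?z = v + u"
      using uv(3) by (simp add: add.commute)
    ultimately show ?thesis
      using column_pair_summand_eq_0[OF assms(4,3,5) uv]
        column_pair_summand_eq_0[OF assms(4,3,5) uv(2,1)] by blast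
  qed
  moreover have "?z \<noteq> 0"
    using short_column(2) by (auto simp: linear_0[OF linear_column_count])
  ultimately show ?thesis
    using column_pair_in_kostka_points assms by (auto simp: irreducibles_def)
qed

lemma initial_pair_column_pair:
  assumes "0 < d" "d < s" "s \<le> r" "b < s" "coprime s r" "a * s + d = b * r"
  shows "initial_pair r (int (a + 1), int b)"
proof -
  have "column_pair a s d b r \<in> hilbert_basis (kostka_cone r)"
    using column_pair_irreducible[OF assms] by (simp only: hilbert_basis_kostka_cone)
  moreover have "Poly_Mapping.lookup (fst (column_pair a s d b r)) 1 = real (a + 1)"
      "Poly_Mapping.lookup (snd (column_pair a s d b r)) 1 = real b"
    using assms by (simp_all add: column_pair_def lookup_add lookup_scaleR lookup_young_column)
  ultimately show ?thesis
    unfolding initial_pair_def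
    by (intro bexI[of _ "column_pair a s d b r"]) (auto simp: case_prod_beta)
qed

theorem theorem6p9:
  fixes l m :: nat
  assumes "0 < m" and "m \<le> l"
    and "gcd (l + 1) (m + 1) = 1"
    and "2 * m > l + 1"
  shows "initial_pair (l + 1) (int l, int m)"
proof -
  have "m \<noteq> l"
    using assms(1,3) by auto
  then have "m < l"
    using assms(2) by simp
  define a d where "a = l - 1" and "d = 2 * m + 1 - l"
  have lengths: "l = a + 1" "2 * m + 1 = l + d"
    using \<open>m < l\<close> assms(4) by (auto simp: a_def d_def)
  then have "a * (m + 1) + d = m * (l + 1)"
    by (simp add: algebra_simps)
  moreover have "coprime (m + 1) (l + 1)"
    using assms(3) by (simp add: coprime_iff_gcd_eq_1 gcd.commute)
  ultimately have "initial_pair (l + 1) (int (a + 1), int m)"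
    using \<open>m < l\<close> assms(4) lengths
    by (intro initial_pair_column_pair[where s = "m + 1" and d = d]) auto
  then show ?thesis
    by (simp add: lengths(1))
qed

end
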